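(* The $\mathbf{T}_0$-fixed locus of $\mathcal{Q}_0(r,n)$ coincides with its $\mathbf{T}$-fixed locus: $\mathcal{Q}_0(r,n)^{\mathbf T_0}=\mathcal{Q}_0(r,n)^{\mathbf T}$.
   Context: Let $V_\infty=\mathbb{C}^r$ with basis $e_a$, and let $A_re_a=e_{a+1}$, $e_{r+1}=0$. $\mathcal{Q}(r,n)$ is the moduli space, up to $GL(V)$, of framed cyclic representations $(V,B_1,B_2,B_3,I,J)$. These satisfy: - $\dim V=n$; - $[B_1,B_2]+IJ=0$, $JB_3=A_rJ$, $B_3I=IA_r$, $[B_3,B_1]=[B_3,B_2]=0$; - no proper nonzero $B_1,B_2,B_3$-invariant subspace contains $\mathrm{Im}\,I$. $\mathcal{Q}_0(r,n)\subset\mathcal{Q}(r,n)$ is the closed subscheme where $J=0$. With $I_a=I(e_a)$ and $J_a$ the components of $J$, the torus $\mathbf{T}=(\mathbb{C}^\times)^3$ acts by $$(t_1,t_2,t_3)\cdot(B_i,I_a,J_a)=(t_iB_i,\ t_3^{a-1}I_a,\ t_1t_2t_3^{1-a}J_a).$$ $\mathbf{T}_0\subset\mathbf{T}$ is the subtorus $t_1t_2t_3=1$, i.e. the image of $(t_1,t_2)\mapsto(t_1,t_2,t_1^{-1}t_2^{-1})$. *)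

theory Defs
  imports "Jordan_Normal_Form.Matrix"
begin

text \<open>Data of a framed representation on V = C^n with framing C^r:
  (B1, B2, B3, I, J), with B_i n x n, I : C^r -> V an n x r matrix,
  J : V -> C^r an r x n matrix. Indices are 0-based: column a of I is I_(a+1).\<close>

type_synonym rep_data = "complex mat \<times> complex mat \<times> complex mat \<times> complex mat \<times> complex mat"

text \<open>A_r e_a = e_(a+1), e_(r+1) = 0 (0-based: entry (i,j) = 1 iff i = j+1).\<close>
definition A_mat :: "nat \<Rightarrow> complex mat" where
  "A_mat r = mat r r (\<lambda>(i,j). if i = Suc j then 1 else 0)"

definition is_subspace :: "nat \<Rightarrow> complex vec set \<Rightarrow> bool" where
  "is_subspace n W \<longleftrightarrow> W \<subseteq> carrier_vec n \<and> 0\<^sub>v n \<in> W \<and>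
     (\<forall>v\<in>W. \<forall>w\<in>W. v + w \<in> W) \<and> (\<forall>c. \<forall>v\<in>W. c \<cdot>\<^sub>v v \<in> W)"

definition cyclic_cond :: "nat \<Rightarrow> nat \<Rightarrow> rep_data \<Rightarrow> bool" where
  "cyclic_cond r n x = (case x of (B1, B2, B3, I, J) \<Rightarrow>
     (\<forall>W. is_subspace n W
        \<and> (\<forall>w\<in>W. B1 *\<^sub>v w \<in> W \<and> B2 *\<^sub>v w \<in> W \<and> B3 *\<^sub>v w \<in> W)
        \<and> (\<forall>u\<in>carrier_vec r. I *\<^sub>v u \<in> W)
        \<longrightarrow> W = carrier_vec n))"

definition is_rep :: "nat \<Rightarrow> nat \<Rightarrow> rep_data \<Rightarrow> bool" where
  "is_rep r n x = (case x of (B1, B2, B3, I, J) \<Rightarrow>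
     B1 \<in> carrier_mat n n \<and> B2 \<in> carrier_mat n n \<and> B3 \<in> carrier_mat n n \<and>
     I \<in> carrier_mat n r \<and> J \<in> carrier_mat r n \<and>
     B1 * B2 - B2 * B1 + I * J = 0\<^sub>m n n \<and>
     J * B3 = A_mat r * J \<and>
     B3 * I = I * A_mat r \<and>
     B3 * B1 = B1 * B3 \<and> B3 * B2 = B2 * B3)"

definition in_Q0 :: "nat \<Rightarrow> nat \<Rightarrow> rep_data \<Rightarrow> bool" where
  "in_Q0 r n x \<longleftrightarrow> is_rep r n x \<and> cyclic_cond r n x \<and> snd (snd (snd (snd x))) = 0\<^sub>m r n"

text \<open>Torus action: (t1,t2,t3).(B_i, I_a, J_a) = (t_i B_i, t3^(a-1) I_a, t1 t2 t3^(1-a) J_a),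
  with a 1-based; here a' = a - 1 is 0-based.\<close>
definition torus_act :: "nat \<Rightarrow> nat \<Rightarrow> complex \<Rightarrow> complex \<Rightarrow> complex \<Rightarrow> rep_data \<Rightarrow> rep_data" where
  "torus_act r n t1 t2 t3 x = (case x of (B1, B2, B3, I, J) \<Rightarrow>
     (t1 \<cdot>\<^sub>m B1, t2 \<cdot>\<^sub>m B2, t3 \<cdot>\<^sub>m B3,
      mat n r (\<lambda>(i,a). t3 ^ a * I $$ (i,a)),
      mat r n (\<lambda>(a,j). t1 * t2 / t3 ^ a * J $$ (a,j))))"

text \<open>GL(V) action g.(B,I,J) = (g B g^-1, g I, J g^-1), h = g^-1.\<close>
definition gl_act :: "complex mat \<Rightarrow> complex mat \<Rightarrow> rep_data \<Rightarrow> rep_data" where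
  "gl_act g h x = (case x of (B1, B2, B3, I, J) \<Rightarrow>
     (g * B1 * h, g * B2 * h, g * B3 * h, g * I, J * h))"

definition gl_equiv :: "nat \<Rightarrow> rep_data \<Rightarrow> rep_data \<Rightarrow> bool" where
  "gl_equiv n x y \<longleftrightarrow> (\<exists>g h. g \<in> carrier_mat n n \<and> h \<in> carrier_mat n n \<and>
      g * h = 1\<^sub>m n \<and> h * g = 1\<^sub>m n \<and> gl_act g h x = y)"

definition fixed_by :: "nat \<Rightarrow> nat \<Rightarrow> complex \<Rightarrow> complex \<Rightarrow> complex \<Rightarrow> rep_data \<Rightarrow> bool" where
  "fixed_by r n t1 t2 t3 x \<longleftrightarrow> gl_equiv n (torus_act r n t1 t2 t3 x) x"

definition T_fixed :: "nat \<Rightarrow> nat \<Rightarrow> rep_data \<Rightarrow> bool" where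
  "T_fixed r n x \<longleftrightarrow> (\<forall>t1 t2 t3. t1 \<noteq> 0 \<and> t2 \<noteq> 0 \<and> t3 \<noteq> 0 \<longrightarrow> fixed_by r n t1 t2 t3 x)"

definition T0_fixed :: "nat \<Rightarrow> nat \<Rightarrow> rep_data \<Rightarrow> bool" where
  "T0_fixed r n x \<longleftrightarrow> (\<forall>t1 t2. t1 \<noteq> 0 \<and> t2 \<noteq> 0 \<longrightarrow> fixed_by r n t1 t2 (1 / (t1 * t2)) x)"

end

(*
  The inclusion of the T-fixed locus in the T0-fixed locus is trivial. Conversely, when J = 0
  the moment map equation makes B1, B2, B3 commute, and B3 I = I A_r shows that the columns of I
  are B3^a v for v = I e_1, so V is spanned by the monomial vectors B1^a B2^b B3^c v.

  A T0-fixed point provides for every t1 t2 t3 = 1 an operator g fixing v with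
  g B_i = t_i B_i g, which acts on B1^a B2^b B3^c v by t1^a t2^b t3^c. A well-chosen element of
  T0 separates monomials with different T0-weights (a - c, b - c); inside one weight class the
  monomials differ by powers of the nilpotent operator B1 B2 B3, which separates them as well.
  Hence the nonzero monomial vectors are linearly independent, so for any (t1, t2, t3) in T the
  operator acting on B1^a B2^b B3^c v by t1^-a t2^-b t3^-c exists, and it conjugates the
  (t1, t2, t3)-translate of the point back to the point.
*)
theory Submission
  imports Defs "Jordan_Normal_Form.Determinant"
begin

section \<open>Vectors, matrices and linear combinations\<close>

lemma smult_zero_vec [simp]: "a \<cdot>\<^sub>v 0\<^sub>v n = (0\<^sub>v n :: 'a :: mult_zero vec)"
  by (intro eq_vecI) auto

lemma mult_mat_zero_vec [simp]: "A \<in> carrier_mat m n \<Longrightarrow> A *\<^sub>v 0\<^sub>v n = (0\<^sub>v m :: 'a :: semiring_0 vec)"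
  by (intro eq_vecI) (auto simp: scalar_prod_def)

lemma smult_mult_mat_vec:
  fixes A :: "'a :: comm_ring_1 mat"
  assumes "A \<in> carrier_mat m n" "x \<in> carrier_vec n"
  shows "(s \<cdot>\<^sub>m A) *\<^sub>v x = s \<cdot>\<^sub>v (A *\<^sub>v x)"
  using assms by (intro eq_vecI) (auto simp: scalar_prod_def sum_distrib_left mult.assoc)

lemma smult_vec_eq_zero_iff:
  fixes x :: "'a :: idom vec"
  assumes "x \<in> carrier_vec n"
  shows "a \<cdot>\<^sub>v x = 0\<^sub>v n \<longleftrightarrow> a = 0 \<or> x = 0\<^sub>v n"
proof
  assume ax: "a \<cdot>\<^sub>v x = 0\<^sub>v n"
  show "a = 0 \<or> x = 0\<^sub>v n"
  proof (cases "a = 0")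
    case False
    have "x = 0\<^sub>v n"
    proof (rule eq_vecI)
      fix i assume "i < dim_vec (0\<^sub>v n :: 'a vec)"
      hence i: "i < n" by simp
      have "a * x $ i = 0" using arg_cong[OF ax, of "\<lambda>v. v $ i"] assms i by simp
      thus "x $ i = 0\<^sub>v n $ i" using False i by simp
    qed (use assms in simp)
    thus ?thesis by simp
  qed simp
qed (use assms in auto)

lemma eq_mat_by_mult_vec:
  fixes A B :: "'a :: comm_ring_1 mat"
  assumes A: "A \<in> carrier_mat n n" and B: "B \<in> carrier_mat n n"
    and eq: "\<And>x. x \<in> carrier_vec n \<Longrightarrow> A *\<^sub>v x = B *\<^sub>v x"
  shows "A = B"
proof (rule eq_matI)
  fix i j assume i: "i < dim_row B" and j: "j < dim_col B"
  have "A $$ (i,j) = (A *\<^sub>v unit_vec n j) $ i" using A B i j by simp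
  also have "\<dots> = B $$ (i,j)" using eq[of "unit_vec n j"] B i j by simp
  finally show "A $$ (i,j) = B $$ (i,j)" .
qed (use A B in auto)

lemma conj_smult_imp_twisted_commute:
  fixes g h B :: "'a :: comm_ring_1 mat"
  assumes g: "g \<in> carrier_mat n n" and h: "h \<in> carrier_mat n n" and B: "B \<in> carrier_mat n n"
    and hg: "h * g = 1\<^sub>m n" and conj: "g * (s \<cdot>\<^sub>m B) * h = B"
  shows "h * B = s \<cdot>\<^sub>m (B * h)"
proof -
  have sB: "s \<cdot>\<^sub>m B \<in> carrier_mat n n" using B by simp
  have "h * B = h * (g * (s \<cdot>\<^sub>m B) * h)" using conj by simp
  also have "\<dots> = (h * g) * (s \<cdot>\<^sub>m B) * h"
    using assoc_mult_mat[OF h mult_carrier_mat[OF g sB] h] assoc_mult_mat[OF h g sB] by simp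
  also have "\<dots> = s \<cdot>\<^sub>m (B * h)"
    unfolding hg left_mult_one_mat[OF sB] using mult_smult_assoc_mat[OF B h] by simp
  finally show ?thesis .
qed

text \<open>\<open>\<Sum>k\<in>S. c k \<cdot> y k\<close> in dimension \<open>n\<close>, written coordinatewise because \<open>'a vec\<close>
  is no monoid (a zero vector needs a dimension), so \<open>sum\<close> is not available.\<close>

definition lincomb_vec :: "nat \<Rightarrow> 'k set \<Rightarrow> ('k \<Rightarrow> 'a :: comm_ring_1) \<Rightarrow> ('k \<Rightarrow> 'a vec) \<Rightarrow> 'a vec" where
  "lincomb_vec n S c y = vec n (\<lambda>i. \<Sum>k\<in>S. c k * y k $ i)"

lemma lincomb_vec_carrier [simp]: "lincomb_vec n S c y \<in> carrier_vec n"
  by (simp add: lincomb_vec_def)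

lemma dim_lincomb_vec [simp]: "dim_vec (lincomb_vec n S c y) = n"
  by (simp add: lincomb_vec_def)

lemma index_lincomb_vec [simp]: "i < n \<Longrightarrow> lincomb_vec n S c y $ i = (\<Sum>k\<in>S. c k * y k $ i)"
  by (simp add: lincomb_vec_def)

lemma lincomb_vec_cong:
  assumes "\<And>k i. k \<in> S \<Longrightarrow> i < n \<Longrightarrow> c k * y k $ i = d k * z k $ i"
  shows "lincomb_vec n S c y = lincomb_vec n S d z"
  using assms by (intro eq_vecI) (auto intro!: sum.cong)

lemma lincomb_vec_singleton: "y k \<in> carrier_vec n \<Longrightarrow> lincomb_vec n {k} c y = c k \<cdot>\<^sub>v y k"
  by (intro eq_vecI) auto

lemma lincomb_vec_add:
  "lincomb_vec n S c y + lincomb_vec n S d y = lincomb_vec n S (\<lambda>k. c k + d k) y"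
  by (intro eq_vecI) (auto simp: sum.distrib distrib_right)

lemma lincomb_vec_diff:
  "lincomb_vec n S (\<lambda>k. c k - d k) y = lincomb_vec n S c y - lincomb_vec n S d y"
  by (intro eq_vecI) (auto simp: sum_subtractf left_diff_distrib)

lemma smult_lincomb_vec: "a \<cdot>\<^sub>v lincomb_vec n S c y = lincomb_vec n S (\<lambda>k. a * c k) y"
  by (intro eq_vecI) (auto simp: sum_distrib_left mult.assoc)

lemma lincomb_vec_extend:
  assumes "finite T" "S \<subseteq> T"
  shows "lincomb_vec n S c y = lincomb_vec n T (\<lambda>k. if k \<in> S then c k else 0) y"
proof (rule eq_vecI)
  fix i assume "i < dim_vec (lincomb_vec n T (\<lambda>k. if k \<in> S then c k else 0) y)"
  hence i: "i < n" by simp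
  have "(\<Sum>k\<in>S. c k * y k $ i) = (\<Sum>k\<in>T. if k \<in> S then c k * y k $ i else 0)"
    using assms by (simp add: sum.inter_restrict[symmetric] Int_absorb1)
  thus "lincomb_vec n S c y $ i = lincomb_vec n T (\<lambda>k. if k \<in> S then c k else 0) y $ i"
    using i by simp (intro sum.cong, auto)
qed simp

lemma lincomb_vec_reindex:
  assumes "inj_on f S"
  shows "lincomb_vec n S c (\<lambda>k. y (f k)) = lincomb_vec n (f ` S) (\<lambda>k. c (inv_into S f k)) y"
  using assms by (intro eq_vecI) (auto simp: sum.reindex)

lemma mult_mat_vec_lincomb_vec:
  assumes A: "A \<in> carrier_mat m n" and y: "\<And>k. k \<in> S \<Longrightarrow> y k \<in> carrier_vec n"
  shows "A *\<^sub>v lincomb_vec n S c y = lincomb_vec m S c (\<lambda>k. A *\<^sub>v y k)"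
proof (rule eq_vecI)
  fix i assume "i < dim_vec (lincomb_vec m S c (\<lambda>k. A *\<^sub>v y k))"
  hence i: "i < m" by simp
  have "(A *\<^sub>v lincomb_vec n S c y) $ i = (\<Sum>j<n. A $$ (i,j) * (\<Sum>k\<in>S. c k * y k $ j))"
    using A i by (simp add: scalar_prod_def lessThan_atLeast0)
  also have "\<dots> = (\<Sum>k\<in>S. \<Sum>j<n. c k * (A $$ (i,j) * y k $ j))"
    by (simp add: sum_distrib_left sum.swap[of _ S] mult.left_commute)
  also have "\<dots> = lincomb_vec m S c (\<lambda>k. A *\<^sub>v y k) $ i"
    using A y[THEN carrier_vecD] i
    by (auto simp: scalar_prod_def sum_distrib_left lessThan_atLeast0 intro!: sum.cong)
  finally show "(A *\<^sub>v lincomb_vec n S c y) $ i = lincomb_vec m S c (\<lambda>k. A *\<^sub>v y k) $ i" .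
qed (use A in simp)

lemma mult_mat_of_lincomb_cols:
  assumes x: "x \<in> carrier_vec n"
  shows "mat m n (\<lambda>(i,j). lincomb_vec m T (E j) y $ i) *\<^sub>v x =
    lincomb_vec m T (\<lambda>k. \<Sum>j<n. x $ j * E j k) y"
proof (rule eq_vecI)
  fix i assume "i < dim_vec (lincomb_vec m T (\<lambda>k. \<Sum>j<n. x $ j * E j k) y)"
  hence i: "i < m" by simp
  have "(mat m n (\<lambda>(i,j). lincomb_vec m T (E j) y $ i) *\<^sub>v x) $ i =
      (\<Sum>j<n. (\<Sum>k\<in>T. E j k * y k $ i) * x $ j)"
    using x i by (simp add: scalar_prod_def lessThan_atLeast0)
  also have "\<dots> = (\<Sum>k\<in>T. (\<Sum>j<n. x $ j * E j k) * y k $ i)"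
    by (simp add: sum_distrib_left sum_distrib_right sum.swap[of _ T] mult_ac)
  finally show "(mat m n (\<lambda>(i,j). lincomb_vec m T (E j) y $ i) *\<^sub>v x) $ i =
      lincomb_vec m T (\<lambda>k. \<Sum>j<n. x $ j * E j k) y $ i"
    using i by simp
qed simp

lemma lincomb_vec_delta:
  assumes "finite S" "k \<in> S" "y k \<in> carrier_vec n"
  shows "lincomb_vec n S (\<lambda>j. if j = k then c j else 0) y = c k \<cdot>\<^sub>v y k"
proof -
  have "lincomb_vec n {k} c y = lincomb_vec n S (\<lambda>j. if j \<in> {k} then c j else 0) y"
    using assms by (intro lincomb_vec_extend) auto
  hence "lincomb_vec n S (\<lambda>j. if j = k then c j else 0) y = lincomb_vec n {k} c y" by simp
  also have "\<dots> = c k \<cdot>\<^sub>v y k" using assms(3) by (rule lincomb_vec_singleton)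
  finally show ?thesis .
qed

lemma lincomb_vec_coordinates:
  assumes C: "\<And>j. j < n \<Longrightarrow> unit_vec n j = lincomb_vec n T (C j) y" and x: "x \<in> carrier_vec n"
  shows "x = lincomb_vec n T (\<lambda>k. \<Sum>j<n. x $ j * C j k) y"
proof -
  have "1\<^sub>m n = mat n n (\<lambda>(i, j). lincomb_vec n T (C j) y $ i)"
  proof (rule eq_matI)
    fix i j assume "i < dim_row (mat n n (\<lambda>(i, j). lincomb_vec n T (C j) y $ i))"
      and "j < dim_col (mat n n (\<lambda>(i, j). lincomb_vec n T (C j) y $ i))"
    hence ij: "i < n" "j < n" by simp_all
    show "1\<^sub>m n $$ (i, j) = mat n n (\<lambda>(i, j). lincomb_vec n T (C j) y $ i) $$ (i, j)"
      using ij C[OF ij(2), symmetric] by (simp del: index_lincomb_vec)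
  qed simp_all
  hence "1\<^sub>m n *\<^sub>v x = lincomb_vec n T (\<lambda>k. \<Sum>j<n. x $ j * C j k) y"
    using mult_mat_of_lincomb_cols[OF x] by simp
  thus ?thesis using x by simp
qed

definition span_vec :: "nat \<Rightarrow> ('k \<Rightarrow> 'a :: comm_ring_1 vec) \<Rightarrow> 'a vec set" where
  "span_vec n y = {x. \<exists>S c. finite S \<and> x = lincomb_vec n S c y}"

lemma lincomb_vec_in_span_vec: "finite S \<Longrightarrow> lincomb_vec n S c y \<in> span_vec n y"
  unfolding span_vec_def by blast

lemma is_subspace_span_vec: "is_subspace n (span_vec n y)"
proof -
  have "0\<^sub>v n = lincomb_vec n {} c y" for c by (intro eq_vecI) auto
  hence "0\<^sub>v n \<in> span_vec n y" by (metis finite.emptyI lincomb_vec_in_span_vec)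
  moreover have "x + x' \<in> span_vec n y" if "x \<in> span_vec n y" "x' \<in> span_vec n y" for x x'
  proof -
    obtain S c where S: "finite S" "x = lincomb_vec n S c y"
      using \<open>x \<in> span_vec n y\<close> unfolding span_vec_def by blast
    obtain T d where T: "finite T" "x' = lincomb_vec n T d y"
      using \<open>x' \<in> span_vec n y\<close> unfolding span_vec_def by blast
    have "x = lincomb_vec n (S \<union> T) (\<lambda>k. if k \<in> S then c k else 0) y"
      unfolding S(2) by (rule lincomb_vec_extend) (use S(1) T(1) in auto)
    moreover have "x' = lincomb_vec n (S \<union> T) (\<lambda>k. if k \<in> T then d k else 0) y"
      unfolding T(2) by (rule lincomb_vec_extend) (use S(1) T(1) in auto)
    ultimately have "x + x' = lincomb_vec n (S \<union> T)
        (\<lambda>k. (if k \<in> S then c k else 0) + (if k \<in> T then d k else 0)) y"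
      by (simp only: lincomb_vec_add)
    thus ?thesis by (metis S(1) T(1) finite_UnI lincomb_vec_in_span_vec)
  qed
  moreover have "a \<cdot>\<^sub>v x \<in> span_vec n y" if "x \<in> span_vec n y" for a x
  proof -
    obtain S c where S: "finite S" "x = lincomb_vec n S c y"
      using \<open>x \<in> span_vec n y\<close> unfolding span_vec_def by blast
    have "a \<cdot>\<^sub>v x = lincomb_vec n S (\<lambda>k. a * c k) y"
      unfolding S(2) by (rule smult_lincomb_vec)
    thus ?thesis by (metis S(1) lincomb_vec_in_span_vec)
  qed
  moreover have "span_vec n y \<subseteq> carrier_vec n" unfolding span_vec_def by auto
  ultimately show ?thesis unfolding is_subspace_def by blast
qed

lemma mult_mat_vec_span_vec:
  assumes B: "B \<in> carrier_mat n n" and y: "\<And>k. y k \<in> carrier_vec n"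
    and By: "\<And>k. B *\<^sub>v y k = y (f k)" and f: "inj f" and x: "x \<in> span_vec n y"
  shows "B *\<^sub>v x \<in> span_vec n y"
proof -
  obtain S c where S: "finite S" "x = lincomb_vec n S c y" using x unfolding span_vec_def by blast
  have "B *\<^sub>v x = lincomb_vec n S c (\<lambda>k. y (f k))"
    unfolding S(2) mult_mat_vec_lincomb_vec[OF B y] By ..
  also have "\<dots> = lincomb_vec n (f ` S) (\<lambda>k. c (inv_into S f k)) y"
    using f by (simp add: lincomb_vec_reindex inj_on_subset)
  finally show ?thesis by (metis S(1) finite_imageI lincomb_vec_in_span_vec)
qed

lemma exists_common_support_span_vec:
  fixes N :: nat
  assumes x: "\<And>j. j < N \<Longrightarrow> x j \<in> span_vec n y"
  shows "\<exists>T C. finite T \<and> (\<forall>j<N. x j = lincomb_vec n T (C j) y)"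
proof -
  have "\<forall>j\<in>{..<N}. \<exists>Sc. finite (fst Sc) \<and> x j = lincomb_vec n (fst Sc) (snd Sc) y"
    using x unfolding span_vec_def by fastforce
  then obtain Sc where Sc: "\<And>j. j < N \<Longrightarrow> finite (fst (Sc j)) \<and> x j = lincomb_vec n (fst (Sc j)) (snd (Sc j)) y"
    by (metis bchoice lessThan_iff)
  define T where "T = (\<Union>j<N. fst (Sc j))"
  have T: "finite T" unfolding T_def using Sc by simp
  have "x j = lincomb_vec n T (\<lambda>k. if k \<in> fst (Sc j) then snd (Sc j) k else 0) y" if "j < N" for j
  proof -
    have "fst (Sc j) \<subseteq> T" unfolding T_def using that by auto
    thus ?thesis using Sc[OF that] lincomb_vec_extend[OF T, of "fst (Sc j)" n "snd (Sc j)" y]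
      by simp
  qed
  thus ?thesis
    using T by (intro exI[of _ T] exI[of _ "\<lambda>j k. if k \<in> fst (Sc j) then snd (Sc j) k else 0"]) simp
qed

lemma lincomb_vec_mem_subspace:
  assumes W: "is_subspace n W" and fin: "finite S" and y: "\<And>k. k \<in> S \<Longrightarrow> y k \<in> W"
  shows "lincomb_vec n S c y \<in> W"
  using fin y
proof (induction S rule: finite_induct)
  case empty
  have "lincomb_vec n {} c y = 0\<^sub>v n" by (intro eq_vecI) auto
  thus ?case using W unfolding is_subspace_def by simp
next
  case (insert k S)
  have "y k \<in> carrier_vec n" using insert.prems W unfolding is_subspace_def by blast
  hence "lincomb_vec n (insert k S) c y = c k \<cdot>\<^sub>v y k + lincomb_vec n S c y"
    using insert.hyps by (intro eq_vecI) auto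
  thus ?case using insert W unfolding is_subspace_def by simp
qed

section \<open>Eigenvectors and iterated matrices\<close>

lemma exists_nontrivial_lincomb_vec_zero:
  fixes y :: "nat \<Rightarrow> 'a :: idom vec"
  assumes y: "\<And>k. k \<le> n \<Longrightarrow> y k \<in> carrier_vec n"
  shows "\<exists>c. (\<exists>k\<le>n. c k \<noteq> 0) \<and> lincomb_vec n {..n} c y = 0\<^sub>v n"
proof -
  define M :: "'a mat" where
    "M = mat\<^sub>r (Suc n) (Suc n) (\<lambda>i. if i = n then 0\<^sub>v (Suc n) else vec (Suc n) (\<lambda>k. y k $ i))"
  have M: "M \<in> carrier_mat (Suc n) (Suc n)" unfolding M_def by simp
  have "det M = 0" unfolding M_def by (rule det_row_0) auto
  then obtain w where w: "w \<in> carrier_vec (Suc n)" "w \<noteq> 0\<^sub>v (Suc n)" "M *\<^sub>v w = 0\<^sub>v (Suc n)"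
    using det_0_iff_vec_prod_zero[OF M] by blast
  have "\<exists>k\<le>n. w $ k \<noteq> 0"
  proof (rule ccontr)
    assume "\<not> ?thesis"
    hence "w = 0\<^sub>v (Suc n)" using w(1) by (intro eq_vecI) auto
    thus False using w(2) by simp
  qed
  moreover have "lincomb_vec n {..n} (\<lambda>k. w $ k) y = 0\<^sub>v n"
  proof (rule eq_vecI)
    fix i assume "i < dim_vec (0\<^sub>v n :: 'a vec)"
    hence i: "i < n" by simp
    have "(M *\<^sub>v w) $ i = (\<Sum>k<Suc n. y k $ i * w $ k)"
      using i w(1) unfolding M_def by (simp add: scalar_prod_def lessThan_atLeast0)
    thus "lincomb_vec n {..n} (\<lambda>k. w $ k) y $ i = 0\<^sub>v n $ i"
      using w(3) i by (simp add: lessThan_Suc_atMost mult.commute)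
  qed simp
  ultimately show ?thesis by blast
qed

text \<open>Induction on the number of eigenvalues that occur: applying \<open>g - a\<close> for an occurring
  eigenvalue \<open>a \<noteq> \<mu>\<close> removes \<open>a\<close> and keeps the eigenvalue-\<open>\<mu>\<close> part up to the factor \<open>\<mu> - a\<close>.\<close>

lemma lincomb_vec_eigencomponent_zero:
  fixes g :: "'a :: field mat"
  assumes g: "g \<in> carrier_mat n n" and fin: "finite S"
    and y: "\<And>k. k \<in> S \<Longrightarrow> y k \<in> carrier_vec n"
    and eig: "\<And>k. k \<in> S \<Longrightarrow> g *\<^sub>v y k = ev k \<cdot>\<^sub>v y k"
    and rel: "lincomb_vec n S c y = 0\<^sub>v n"
  shows "lincomb_vec n S (\<lambda>k. if ev k = \<mu> then c k else 0) y = 0\<^sub>v n"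
  using rel
proof (induction "card (ev ` {k\<in>S. c k \<noteq> 0})" arbitrary: c rule: less_induct)
  case less
  let ?L = "ev ` {k\<in>S. c k \<noteq> 0}"
  show ?case
  proof (cases "?L \<subseteq> {\<mu>}")
    case True
    have "lincomb_vec n S (\<lambda>k. if ev k = \<mu> then c k else 0) y = lincomb_vec n S c y"
      using True by (intro lincomb_vec_cong) auto
    thus ?thesis using less.prems by simp
  next
    case False
    then obtain a where a: "a \<in> ?L" "a \<noteq> \<mu>" by blast
    define c' where "c' k = c k * (ev k - a)" for k
    have "g *\<^sub>v lincomb_vec n S c y = lincomb_vec n S c (\<lambda>k. g *\<^sub>v y k)"
      by (rule mult_mat_vec_lincomb_vec[OF g y])
    also have "\<dots> = lincomb_vec n S (\<lambda>k. c k * ev k) y"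
      using eig y[THEN carrier_vecD] by (intro lincomb_vec_cong) (auto simp: mult.assoc)
    finally have "lincomb_vec n S (\<lambda>k. c k * ev k) y = 0\<^sub>v n" using less.prems g by simp
    moreover have "lincomb_vec n S c' y =
        lincomb_vec n S (\<lambda>k. c k * ev k) y + (- a) \<cdot>\<^sub>v lincomb_vec n S c y"
      unfolding smult_lincomb_vec lincomb_vec_add c'_def by (simp add: algebra_simps)
    ultimately have rel': "lincomb_vec n S c' y = 0\<^sub>v n" using less.prems by simp
    have L': "ev ` {k\<in>S. c' k \<noteq> 0} = ?L - {a}" unfolding c'_def by auto
    have "finite ?L" using fin by simp
    hence "card (?L - {a}) < card ?L" using a(1) by (rule card_Diff1_less)
    hence "card (ev ` {k\<in>S. c' k \<noteq> 0}) < card ?L" unfolding L' .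
    hence IH: "lincomb_vec n S (\<lambda>k. if ev k = \<mu> then c' k else 0) y = 0\<^sub>v n"
      using less.hyps rel' by blast
    have "(\<mu> - a) \<cdot>\<^sub>v lincomb_vec n S (\<lambda>k. if ev k = \<mu> then c k else 0) y =
        lincomb_vec n S (\<lambda>k. if ev k = \<mu> then c' k else 0) y"
      unfolding smult_lincomb_vec c'_def by (intro lincomb_vec_cong) (auto simp: mult_ac)
    hence "(\<mu> - a) \<cdot>\<^sub>v lincomb_vec n S (\<lambda>k. if ev k = \<mu> then c k else 0) y = 0\<^sub>v n"
      using IH by simp
    thus ?thesis using a(2) by (simp add: smult_vec_eq_zero_iff)
  qed
qed

lemma lincomb_vec_zero_distinct_eigenvalues:
  fixes g :: "'a :: field mat"
  assumes g: "g \<in> carrier_mat n n" and fin: "finite S"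
    and y: "\<And>k. k \<in> S \<Longrightarrow> y k \<in> carrier_vec n"
    and eig: "\<And>k. k \<in> S \<Longrightarrow> g *\<^sub>v y k = ev k \<cdot>\<^sub>v y k"
    and inj: "inj_on ev S"
    and rel: "lincomb_vec n S c y = 0\<^sub>v n"
    and k: "k \<in> S" and nz: "y k \<noteq> 0\<^sub>v n"
  shows "c k = 0"
proof -
  have "lincomb_vec n S (\<lambda>j. if ev j = ev k then c j else 0) y =
      lincomb_vec n S (\<lambda>j. if j = k then c j else 0) y"
    using inj k by (intro lincomb_vec_cong) (auto dest: inj_onD)
  also have "\<dots> = c k \<cdot>\<^sub>v y k"
    using fin k y[OF k] by (rule lincomb_vec_delta)
  finally have "c k \<cdot>\<^sub>v y k = 0\<^sub>v n"
    using lincomb_vec_eigencomponent_zero[OF g fin y eig rel] by simp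
  thus ?thesis using nz y[OF k] by (simp add: smult_vec_eq_zero_iff)
qed

lemma exists_zero_eigenvector_distinct_eigenvalues:
  fixes g :: "'a :: field mat"
  assumes g: "g \<in> carrier_mat n n"
    and y: "\<And>k. k \<le> n \<Longrightarrow> y k \<in> carrier_vec n"
    and eig: "\<And>k. k \<le> n \<Longrightarrow> g *\<^sub>v y k = ev k \<cdot>\<^sub>v y k"
    and inj: "inj_on ev {..n}"
  shows "\<exists>k\<le>n. y k = 0\<^sub>v n"
proof -
  obtain c where c: "(\<exists>k\<le>n. c k \<noteq> 0) \<and> lincomb_vec n {..n} c y = 0\<^sub>v n"
    using exists_nontrivial_lincomb_vec_zero[OF y] ..
  then obtain k where k: "k \<le> n" "c k \<noteq> 0" by blast
  have y': "\<And>k. k \<in> {..n} \<Longrightarrow> y k \<in> carrier_vec n"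
    and eig': "\<And>k. k \<in> {..n} \<Longrightarrow> g *\<^sub>v y k = ev k \<cdot>\<^sub>v y k"
    using y eig by auto
  have "y k = 0\<^sub>v n"
    using lincomb_vec_zero_distinct_eigenvalues[OF g finite_atMost y' eig' inj conjunct2[OF c], of k] k by auto
  thus ?thesis using k(1) by blast
qed

abbreviation mat_iter :: "'a :: semiring_0 mat \<Rightarrow> nat \<Rightarrow> 'a vec \<Rightarrow> 'a vec" where
  "mat_iter A k \<equiv> (\<lambda>y. A *\<^sub>v y) ^^ k"

lemma mat_iter_carrier [simp]:
  "A \<in> carrier_mat n n \<Longrightarrow> y \<in> carrier_vec n \<Longrightarrow> mat_iter A k y \<in> carrier_vec n"
  by (induction k) auto

lemma mat_iter_zero [simp]: "A \<in> carrier_mat n n \<Longrightarrow> mat_iter A k (0\<^sub>v n) = 0\<^sub>v n"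
  by (induction k) auto

lemma mat_iter_smult:
  fixes A :: "'a :: field mat"
  assumes "A \<in> carrier_mat n n" "y \<in> carrier_vec n"
  shows "mat_iter A k (a \<cdot>\<^sub>v y) = a \<cdot>\<^sub>v mat_iter A k y"
proof (induction k)
  case (Suc k)
  then show ?case using mult_mat_vec[OF assms(1) mat_iter_carrier[OF assms]] by simp
qed simp

lemma mat_iter_lincomb_vec:
  fixes A :: "'a :: comm_ring_1 mat"
  assumes A: "A \<in> carrier_mat n n" and y: "\<And>k. k \<in> S \<Longrightarrow> y k \<in> carrier_vec n"
  shows "mat_iter A m (lincomb_vec n S c y) = lincomb_vec n S c (\<lambda>k. mat_iter A m (y k))"
proof (induction m)
  case (Suc m)
  have "mat_iter A (Suc m) (lincomb_vec n S c y) = A *\<^sub>v lincomb_vec n S c (\<lambda>k. mat_iter A m (y k))"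
    using Suc by simp
  also have "\<dots> = lincomb_vec n S c (\<lambda>k. mat_iter A (Suc m) (y k))"
    using mult_mat_vec_lincomb_vec[OF A, of S "\<lambda>k. mat_iter A m (y k)"] A y by simp
  finally show ?case .
qed simp

lemma mat_iter_commute:
  assumes A: "A \<in> carrier_mat n n" and B: "B \<in> carrier_mat n n" and AB: "A * B = B * A"
    and y: "y \<in> carrier_vec n"
  shows "B *\<^sub>v mat_iter A k y = mat_iter A k (B *\<^sub>v y)"
proof (induction k)
  case (Suc k)
  have x: "mat_iter A k y \<in> carrier_vec n" using A y by simp
  have "B *\<^sub>v (A *\<^sub>v mat_iter A k y) = (B * A) *\<^sub>v mat_iter A k y"
    using assoc_mult_mat_vec[OF B A x] by simp
  also have "\<dots> = A *\<^sub>v (B *\<^sub>v mat_iter A k y)"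
    using assoc_mult_mat_vec[OF A B x] AB by simp
  finally show ?case using Suc by simp
qed simp

lemma mat_iter_twisted_commute:
  fixes A g :: "'a :: field mat"
  assumes A: "A \<in> carrier_mat n n" and g: "g \<in> carrier_mat n n"
    and gA: "g * A = s \<cdot>\<^sub>m (A * g)" and y: "y \<in> carrier_vec n"
  shows "g *\<^sub>v mat_iter A k y = s ^ k \<cdot>\<^sub>v mat_iter A k (g *\<^sub>v y)"
proof (induction k)
  case (Suc k)
  have gAv: "g *\<^sub>v (A *\<^sub>v x) = s \<cdot>\<^sub>v (A *\<^sub>v (g *\<^sub>v x))" if x: "x \<in> carrier_vec n" for x
  proof -
    have "g *\<^sub>v (A *\<^sub>v x) = (s \<cdot>\<^sub>m (A * g)) *\<^sub>v x"
      using assoc_mult_mat_vec[OF g A x] gA by simp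
    also have "\<dots> = s \<cdot>\<^sub>v (A *\<^sub>v (g *\<^sub>v x))"
      using smult_mult_mat_vec[OF mult_carrier_mat[OF A g] x] A g x by simp
    finally show ?thesis .
  qed
  have "g *\<^sub>v mat_iter A (Suc k) y = s \<cdot>\<^sub>v (A *\<^sub>v (s ^ k \<cdot>\<^sub>v mat_iter A k (g *\<^sub>v y)))"
    using gAv[of "mat_iter A k y"] Suc A y by simp
  also have "\<dots> = s ^ Suc k \<cdot>\<^sub>v mat_iter A (Suc k) (g *\<^sub>v y)"
    using A g y by (simp add: mult_mat_vec smult_smult_assoc mult.commute)
  finally show ?case .
qed simp

lemma exists_last_nonzero_iterate:
  assumes P: "P \<in> carrier_mat n n" and nil: "mat_iter P N w = 0\<^sub>v n"
    and nz: "mat_iter P j w \<noteq> 0\<^sub>v n"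
  shows "\<exists>J\<ge>j. mat_iter P J w \<noteq> 0\<^sub>v n \<and> (\<forall>i>J. mat_iter P i w = 0\<^sub>v n)"
proof -
  have vanish: "mat_iter P i w = 0\<^sub>v n" if "N \<le> i" for i
    using funpow_add[of "i - N" N "\<lambda>y. P *\<^sub>v y"] that nil P by simp
  define A where "A = {i. i \<le> N \<and> mat_iter P i w \<noteq> 0\<^sub>v n}"
  have finA: "finite A" unfolding A_def by (rule finite_subset[of _ "{..N}"]) auto
  have "\<not> N \<le> j" using vanish[of j] nz by auto
  hence "j \<in> A" using nz unfolding A_def by simp
  hence "j \<le> Max A" "mat_iter P (Max A) w \<noteq> 0\<^sub>v n"
    using Max_ge[OF finA] Max_in[OF finA] unfolding A_def by auto
  moreover have "mat_iter P i w = 0\<^sub>v n" if "Max A < i" for i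
  proof (cases "N \<le> i")
    case False
    hence "i \<notin> A" using that Max_ge[OF finA, of i] by auto
    thus ?thesis using False unfolding A_def by simp
  qed (rule vanish)
  ultimately show ?thesis by blast
qed

text \<open>Among the nonzero terms take the one with the least exponent \<open>e k0\<close>, and let \<open>J\<close> be the
  last exponent with \<open>P^J w \<noteq> 0\<close>: applying \<open>P^(J - e k0)\<close> kills every other term.\<close>

lemma lincomb_vec_iterates_zero:
  fixes P :: "'a :: field mat"
  assumes P: "P \<in> carrier_mat n n" and w: "w \<in> carrier_vec n"
    and nil: "mat_iter P N w = 0\<^sub>v n"
    and fin: "finite S" and inj: "inj_on e S"
    and rel: "lincomb_vec n S d (\<lambda>k. mat_iter P (e k) w) = 0\<^sub>v n"
    and k: "k \<in> S" and nz: "mat_iter P (e k) w \<noteq> 0\<^sub>v n"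
  shows "d k = 0"
proof (rule ccontr)
  assume "d k \<noteq> 0"
  define Z where "Z = {k\<in>S. d k \<noteq> 0 \<and> mat_iter P (e k) w \<noteq> 0\<^sub>v n}"
  obtain k0 where k0: "k0 \<in> Z" and least: "\<And>k. k \<in> Z \<Longrightarrow> e k0 \<le> e k"
    using ex_has_least_nat[of "\<lambda>k. k \<in> Z" k e] k nz \<open>d k \<noteq> 0\<close> unfolding Z_def by blast
  obtain J where J: "e k0 \<le> J" "mat_iter P J w \<noteq> 0\<^sub>v n"
    and beyond: "\<And>i. J < i \<Longrightarrow> mat_iter P i w = 0\<^sub>v n"
    using exists_last_nonzero_iterate[OF P nil, of "e k0"] k0 unfolding Z_def by auto
  define m where "m = J - e k0"
  have iter_add: "mat_iter P m (mat_iter P i w) = mat_iter P (m + i) w" for i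
    by (simp add: funpow_add)
  have "0\<^sub>v n = mat_iter P m (lincomb_vec n S d (\<lambda>k. mat_iter P (e k) w))"
    unfolding rel using mat_iter_zero[OF P] by simp
  also have "\<dots> = lincomb_vec n S d (\<lambda>k. mat_iter P (m + e k) w)"
    using mat_iter_lincomb_vec[OF P, of S "\<lambda>k. mat_iter P (e k) w"] P w by (simp add: iter_add)
  also have "\<dots> = lincomb_vec n S (\<lambda>k. if k = k0 then d k else 0) (\<lambda>k. mat_iter P (m + e k) w)"
  proof (rule lincomb_vec_cong)
    fix k i assume k: "k \<in> S" and i: "i < n"
    show "d k * mat_iter P (m + e k) w $ i = (if k = k0 then d k else 0) * mat_iter P (m + e k) w $ i"
    proof (cases "k \<in> Z - {k0}")
      case True
      hence "e k0 \<le> e k" "e k \<noteq> e k0"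
        using least[of k] inj_onD[OF inj, of k k0] k0 k unfolding Z_def by auto
      hence "mat_iter P (m + e k) w = 0\<^sub>v n" using beyond J(1) unfolding m_def by simp
      thus ?thesis using i by simp
    next
      case False
      hence "k = k0 \<or> d k = 0 \<or> mat_iter P (m + e k) w = 0\<^sub>v n"
        using k iter_add[of "e k"] P unfolding Z_def by auto
      thus ?thesis using i by auto
    qed
  qed
  also have "\<dots> = d k0 \<cdot>\<^sub>v mat_iter P J w"
    using lincomb_vec_delta[OF fin, of k0 "\<lambda>k. mat_iter P (m + e k) w" n d] k0 P w J(1)
    unfolding Z_def m_def by simp
  finally have "d k0 \<cdot>\<^sub>v mat_iter P J w = 0\<^sub>v n" ..
  thus False
    using J(2) k0 P w smult_vec_eq_zero_iff[of "mat_iter P J w" n "d k0"] unfolding Z_def by simp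
qed

section \<open>Commuting triples with a cyclic vector\<close>

locale commuting_cyclic_triple =
  fixes n :: nat and B1 B2 B3 :: "complex mat" and v :: "complex vec"
  assumes B1: "B1 \<in> carrier_mat n n" and B2: "B2 \<in> carrier_mat n n" and B3: "B3 \<in> carrier_mat n n"
    and v: "v \<in> carrier_vec n"
    and commute_12: "B1 * B2 = B2 * B1" and commute_13: "B1 * B3 = B3 * B1"
    and commute_23: "B2 * B3 = B3 * B2"
    and cyclic: "\<And>W. is_subspace n W \<Longrightarrow> (\<forall>w\<in>W. B1 *\<^sub>v w \<in> W \<and> B2 *\<^sub>v w \<in> W \<and> B3 *\<^sub>v w \<in> W) \<Longrightarrow>
      v \<in> W \<Longrightarrow> W = carrier_vec n"
begin

definition monomial_vec :: "nat \<times> nat \<times> nat \<Rightarrow> complex vec" where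
  "monomial_vec m = (case m of (a, b, c) \<Rightarrow> mat_iter B1 a (mat_iter B2 b (mat_iter B3 c v)))"

lemma monomial_vec_carrier [simp]: "monomial_vec m \<in> carrier_vec n"
  unfolding monomial_vec_def using B1 B2 B3 v by (simp split: prod.splits)

lemma B1_monomial_vec: "B1 *\<^sub>v monomial_vec (a, b, c) = monomial_vec (Suc a, b, c)"
  unfolding monomial_vec_def by simp

lemma B2_monomial_vec: "B2 *\<^sub>v monomial_vec (a, b, c) = monomial_vec (a, Suc b, c)"
  unfolding monomial_vec_def
  using mat_iter_commute[OF B1 B2 commute_12] B2 B3 v by simp

lemma B3_monomial_vec: "B3 *\<^sub>v monomial_vec (a, b, c) = monomial_vec (a, b, Suc c)"
  unfolding monomial_vec_def
  using mat_iter_commute[OF B1 B3 commute_13] mat_iter_commute[OF B2 B3 commute_23] B2 B3 v by simp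

lemma monomial_vec_00: "monomial_vec (0, 0, c) = mat_iter B3 c v"
  unfolding monomial_vec_def by simp

lemma iter_B123_monomial_vec:
  "mat_iter (B1 * B2 * B3) j (monomial_vec (a, b, c)) = monomial_vec (a + j, b + j, c + j)"
proof (induction j)
  case (Suc j)
  let ?m = "monomial_vec (a + j, b + j, c + j)"
  have "(B1 * B2 * B3) *\<^sub>v ?m = B1 *\<^sub>v (B2 *\<^sub>v (B3 *\<^sub>v ?m))"
    using assoc_mult_mat_vec[OF mult_carrier_mat[OF B1 B2] B3 monomial_vec_carrier]
      assoc_mult_mat_vec[OF B1 B2 mult_mat_vec_carrier[OF B3 monomial_vec_carrier]] by simp
  thus ?case using Suc by (simp add: B1_monomial_vec B2_monomial_vec B3_monomial_vec)
qed simp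

lemma span_vec_monomial_vecs: "span_vec n monomial_vec = carrier_vec n"
proof (rule cyclic[OF is_subspace_span_vec])
  have "lincomb_vec n {(0, 0, 0)} (\<lambda>_. 1) monomial_vec = v"
    using lincomb_vec_singleton[of monomial_vec "(0, 0, 0)" n "\<lambda>_. 1"] v by (simp add: monomial_vec_00)
  thus "v \<in> span_vec n monomial_vec" by (metis finite.emptyI finite.insertI lincomb_vec_in_span_vec)
  show "\<forall>w\<in>span_vec n monomial_vec. B1 *\<^sub>v w \<in> span_vec n monomial_vec \<and>
      B2 *\<^sub>v w \<in> span_vec n monomial_vec \<and> B3 *\<^sub>v w \<in> span_vec n monomial_vec"
  proof (intro ballI conjI)
    fix w assume w: "w \<in> span_vec n monomial_vec"
    show "B1 *\<^sub>v w \<in> span_vec n monomial_vec"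
      by (rule mult_mat_vec_span_vec[OF B1 _ _ _ w, of "\<lambda>(a, b, c). (Suc a, b, c)"])
         (auto simp: B1_monomial_vec inj_def)
    show "B2 *\<^sub>v w \<in> span_vec n monomial_vec"
      by (rule mult_mat_vec_span_vec[OF B2 _ _ _ w, of "\<lambda>(a, b, c). (a, Suc b, c)"])
         (auto simp: B2_monomial_vec inj_def)
    show "B3 *\<^sub>v w \<in> span_vec n monomial_vec"
      by (rule mult_mat_vec_span_vec[OF B3 _ _ _ w, of "\<lambda>(a, b, c). (a, b, Suc c)"])
         (auto simp: B3_monomial_vec inj_def)
  qed
qed

lemma eq_mat_by_monomial_vecs:
  assumes M1: "M1 \<in> carrier_mat n n" and M2: "M2 \<in> carrier_mat n n"
    and eq: "\<And>m. M1 *\<^sub>v monomial_vec m = M2 *\<^sub>v monomial_vec m"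
  shows "M1 = M2"
proof (rule eq_mat_by_mult_vec[OF M1 M2])
  fix x :: "complex vec" assume "x \<in> carrier_vec n"
  then obtain S c where x: "x = lincomb_vec n S c monomial_vec"
    unfolding span_vec_monomial_vecs[symmetric] span_vec_def by blast
  have "M1 *\<^sub>v x = lincomb_vec n S c (\<lambda>k. M1 *\<^sub>v monomial_vec k)"
    unfolding x by (rule mult_mat_vec_lincomb_vec[OF M1]) simp
  also have "\<dots> = M2 *\<^sub>v x"
    unfolding x eq by (rule mult_mat_vec_lincomb_vec[OF M2, symmetric]) simp
  finally show "M1 *\<^sub>v x = M2 *\<^sub>v x" .
qed

lemma diagonal_conjugation:
  assumes G: "G \<in> carrier_mat n n" and H: "H \<in> carrier_mat n n" and B: "B \<in> carrier_mat n n"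
    and eG: "\<And>m. G *\<^sub>v monomial_vec m = \<psi>1 m \<cdot>\<^sub>v monomial_vec m"
    and eH: "\<And>m. H *\<^sub>v monomial_vec m = \<psi>2 m \<cdot>\<^sub>v monomial_vec m"
    and shift: "\<And>m. B *\<^sub>v monomial_vec m = monomial_vec (\<sigma> m)"
    and scale: "\<And>m. \<psi>1 (\<sigma> m) * s * \<psi>2 m = 1"
  shows "G * (s \<cdot>\<^sub>m B) * H = B"
proof (rule eq_mat_by_monomial_vecs)
  have sB: "s \<cdot>\<^sub>m B \<in> carrier_mat n n" using B by simp
  show "G * (s \<cdot>\<^sub>m B) * H \<in> carrier_mat n n"
    using mult_carrier_mat[OF mult_carrier_mat[OF G sB] H] .
  show "B \<in> carrier_mat n n" by fact
  fix m
  have "(G * (s \<cdot>\<^sub>m B) * H) *\<^sub>v monomial_vec m = G *\<^sub>v ((s \<cdot>\<^sub>m B) *\<^sub>v (\<psi>2 m \<cdot>\<^sub>v monomial_vec m))"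
    using assoc_mult_mat_vec[OF mult_carrier_mat[OF G sB] H monomial_vec_carrier]
      assoc_mult_mat_vec[OF G sB mult_mat_vec_carrier[OF H monomial_vec_carrier]] eH by simp
  also have "\<dots> = (\<psi>1 (\<sigma> m) * s * \<psi>2 m) \<cdot>\<^sub>v monomial_vec (\<sigma> m)"
    using G B smult_mult_mat_vec[OF B] mult_mat_vec[OF B monomial_vec_carrier] mult_mat_vec[OF G]
    by (simp add: shift eG smult_smult_assoc mult_ac)
  also have "\<dots> = B *\<^sub>v monomial_vec m" using scale shift by simp
  finally show "(G * (s \<cdot>\<^sub>m B) * H) *\<^sub>v monomial_vec m = B *\<^sub>v monomial_vec m" .
qed

end

definition monomial_weight :: "complex \<Rightarrow> complex \<Rightarrow> complex \<Rightarrow> nat \<times> nat \<times> nat \<Rightarrow> complex" where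
  "monomial_weight t1 t2 t3 m = (case m of (a, b, c) \<Rightarrow> t1 ^ a * t2 ^ b * t3 ^ c)"

text \<open>The exponents of \<open>t1, t2\<close> in the weight \<open>t1^a t2^b (t1 t2)^-c\<close> of the monomial
  vector \<open>B1^a B2^b B3^c v\<close> under \<open>T0\<close>.\<close>

definition T0_weight :: "nat \<times> nat \<times> nat \<Rightarrow> int \<times> int" where
  "T0_weight m = (case m of (a, b, c) \<Rightarrow> (int a - int c, int b - int c))"

lemma T0_weight_eq_imp_diagonal_shift:
  assumes "T0_weight (a', b', c') = T0_weight (a, b, c)"
  defines "j \<equiv> min a (min b c)" and "j' \<equiv> min a' (min b' c')"
  shows "(a', b', c') = (a - j + j', b - j + j', c - j + j')"
  using assms unfolding T0_weight_def by (auto simp: min_def)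

lemma two_power_inject: "(2 :: complex) ^ i = 2 ^ j \<longleftrightarrow> i = j"
proof
  assume "(2 :: complex) ^ i = 2 ^ j"
  hence "of_nat (2 ^ i) = (of_nat (2 ^ j) :: complex)" by simp
  hence "(2 :: nat) ^ i = 2 ^ j" using of_nat_eq_iff by blast
  thus "i = j" by simp
qed simp

text \<open>The weights of \<open>(2, 2^K, 2^-(K+1))\<close> encode \<open>T0_weight\<close> as the exponent \<open>(a - c) + K (b - c)\<close>
  of 2, which determines \<open>T0_weight\<close> for monomials of small enough degree.\<close>

lemma T0_weight_eq_of_monomial_weight_eq:
  fixes K :: nat
  assumes small: "a + c' < K" "a' + c < K"
    and eq: "monomial_weight 2 (2 ^ K) (1 / 2 ^ Suc K) (a, b, c) =
      monomial_weight 2 (2 ^ K) (1 / 2 ^ Suc K) (a', b', c')"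
  shows "T0_weight (a, b, c) = T0_weight (a', b', c')"
proof -
  have "(2 :: complex) ^ (a + K * b + Suc K * c') = 2 ^ (a' + K * b' + Suc K * c)"
    using eq unfolding monomial_weight_def
    by (simp add: power_add power_mult power_one_over field_simps mult.commute)
  hence "a + K * b + Suc K * c' = a' + K * b' + Suc K * c" by (simp only: two_power_inject)
  hence eq_int: "(int a - int c) - (int a' - int c') = int K * ((int b' - int c') - (int b - int c))"
    by (simp add: algebra_simps flip: of_nat_add of_nat_mult)
  define y where "y = (int b' - int c') - (int b - int c)"
  have small_y: "\<bar>int K * y\<bar> < int K" using small eq_int unfolding y_def by linarith
  have "y = 0"
  proof (rule ccontr)
    assume "y \<noteq> 0"
    hence "int K * 1 \<le> int K * \<bar>y\<bar>" by (intro mult_left_mono) auto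
    thus False using small_y by (simp add: abs_mult)
  qed
  thus ?thesis using eq_int unfolding y_def T0_weight_def by simp
qed

text \<open>\<open>g\<close> is the inverse of the element of \<open>GL(V)\<close> that undoes the action of \<open>(t1, t2, t3)\<close>;
  with this normalisation \<open>B1^a B2^b B3^c v\<close> becomes an eigenvector of \<open>g\<close> for \<open>t1^a t2^b t3^c\<close>.\<close>

locale T0_fixed_triple = commuting_cyclic_triple +
  assumes T0_symmetry: "\<And>t1 t2 t3. t1 * t2 * t3 = 1 \<Longrightarrow> \<exists>g\<in>carrier_mat n n.
    g * B1 = t1 \<cdot>\<^sub>m (B1 * g) \<and> g * B2 = t2 \<cdot>\<^sub>m (B2 * g) \<and> g * B3 = t3 \<cdot>\<^sub>m (B3 * g) \<and> g *\<^sub>v v = v"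
begin

lemma T0_eigenbasis:
  assumes "t1 * t2 * t3 = 1"
  shows "\<exists>g\<in>carrier_mat n n. \<forall>m. g *\<^sub>v monomial_vec m = monomial_weight t1 t2 t3 m \<cdot>\<^sub>v monomial_vec m"
proof -
  obtain g where g: "g \<in> carrier_mat n n" and g1: "g * B1 = t1 \<cdot>\<^sub>m (B1 * g)"
    and g2: "g * B2 = t2 \<cdot>\<^sub>m (B2 * g)" and g3: "g * B3 = t3 \<cdot>\<^sub>m (B3 * g)" and gv: "g *\<^sub>v v = v"
    using T0_symmetry[OF assms] by blast
  have "g *\<^sub>v monomial_vec (a, b, c) = monomial_weight t1 t2 t3 (a, b, c) \<cdot>\<^sub>v monomial_vec (a, b, c)"
    for a b c
  proof -
    let ?z3 = "mat_iter B3 c v" and ?z2 = "mat_iter B2 b (mat_iter B3 c v)"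
    have z3: "?z3 \<in> carrier_vec n" and z2: "?z2 \<in> carrier_vec n" using B2 B3 v by simp_all
    have "g *\<^sub>v ?z3 = t3 ^ c \<cdot>\<^sub>v ?z3"
      using mat_iter_twisted_commute[OF B3 g g3 v] gv by simp
    hence "g *\<^sub>v ?z2 = t2 ^ b \<cdot>\<^sub>v (t3 ^ c \<cdot>\<^sub>v ?z2)"
      using mat_iter_twisted_commute[OF B2 g g2 z3] mat_iter_smult[OF B2 z3] by simp
    hence "g *\<^sub>v monomial_vec (a, b, c) = t1 ^ a \<cdot>\<^sub>v (t2 ^ b \<cdot>\<^sub>v (t3 ^ c \<cdot>\<^sub>v monomial_vec (a, b, c)))"
      unfolding monomial_vec_def using mat_iter_twisted_commute[OF B1 g g1 z2] B1 z2
      by (simp add: mat_iter_smult)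
    thus ?thesis unfolding monomial_weight_def by (simp add: smult_smult_assoc mult.assoc)
  qed
  thus ?thesis using g by auto
qed

text \<open>The vectors \<open>monomial_vec (a + k, b, c)\<close> are eigenvectors of \<open>(2, 1, 1/2) \<in> T0\<close> with
  the pairwise distinct eigenvalues \<open>2^(a + k - c)\<close>, so one of the first \<open>n + 1\<close> of them vanishes.\<close>

lemma monomial_vec_nilpotent: "monomial_vec (a + n, b, c) = 0\<^sub>v n"
proof -
  obtain g where g: "g \<in> carrier_mat n n"
    and eig: "\<And>m. g *\<^sub>v monomial_vec m = monomial_weight 2 1 (1/2) m \<cdot>\<^sub>v monomial_vec m"
    using T0_eigenbasis[of 2 1 "1/2"] by auto
  have inj: "inj_on (\<lambda>k. monomial_weight 2 1 (1/2) (a + k, b, c)) {..n}"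
    by (rule inj_onI) (simp add: monomial_weight_def two_power_inject)
  have "\<exists>k\<le>n. monomial_vec (a + k, b, c) = 0\<^sub>v n"
    by (rule exists_zero_eigenvector_distinct_eigenvalues[OF g _ _ inj]) (simp_all add: eig)
  then obtain k where k: "k \<le> n" "monomial_vec (a + k, b, c) = 0\<^sub>v n" by blast
  have "monomial_vec (a + k + j, b, c) = 0\<^sub>v n" for j
  proof (induction j)
    case (Suc j)
    then show ?case using B1_monomial_vec[of "a + k + j" b c] B1 by simp
  qed (use k in simp)
  from this[of "n - k"] show ?thesis using k(1) by simp
qed

lemma lincomb_monomial_vecs_zero_same_T0_weight:
  assumes fin: "finite S" and rel: "lincomb_vec n S d monomial_vec = 0\<^sub>v n"
    and same: "\<And>k'. k' \<in> S \<Longrightarrow> d k' \<noteq> 0 \<Longrightarrow> T0_weight k' = T0_weight k"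
    and k: "k \<in> S" and nz: "monomial_vec k \<noteq> 0\<^sub>v n"
  shows "d k = 0"
proof (rule ccontr)
  assume dk: "d k \<noteq> 0"
  obtain a b c where k_eq: "k = (a, b, c)" by (cases k)
  define j where "j = min a (min b c)"
  define w where "w = monomial_vec (a - j, b - j, c - j)"
  define P where "P = B1 * B2 * B3"
  define e :: "nat \<times> nat \<times> nat \<Rightarrow> nat" where "e = (\<lambda>(a', b', c'). min a' (min b' c'))"
  define S' where "S' = {k'\<in>S. d k' \<noteq> 0}"
  have P: "P \<in> carrier_mat n n" unfolding P_def using B1 B2 B3 by simp
  have w: "w \<in> carrier_vec n" unfolding w_def by simp
  have diag: "k' = (a - j + e k', b - j + e k', c - j + e k')" if "k' \<in> S'" for k'
  proof -
    obtain a' b' c' where k': "k' = (a', b', c')" by (cases k')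
    have "T0_weight (a', b', c') = T0_weight (a, b, c)"
      using same that unfolding k' k_eq S'_def by auto
    thus ?thesis using T0_weight_eq_imp_diagonal_shift unfolding k' e_def j_def by simp
  qed
  have shape: "monomial_vec k' = mat_iter P (e k') w" if "k' \<in> S'" for k'
    unfolding P_def w_def iter_B123_monomial_vec using diag[OF that] by simp
  have inj: "inj_on e S'"
    by (rule inj_onI) (metis diag)
  have "lincomb_vec n S' d (\<lambda>k'. mat_iter P (e k') w) = lincomb_vec n S' d monomial_vec"
    using shape by (intro lincomb_vec_cong) simp
  also have "\<dots> = lincomb_vec n S (\<lambda>k'. if k' \<in> S' then d k' else 0) monomial_vec"
    by (rule lincomb_vec_extend) (use fin in \<open>auto simp: S'_def\<close>)
  also have "\<dots> = lincomb_vec n S d monomial_vec"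
    by (intro lincomb_vec_cong) (simp add: S'_def)
  finally have rel': "lincomb_vec n S' d (\<lambda>k'. mat_iter P (e k') w) = 0\<^sub>v n" using rel by simp
  have nil: "mat_iter P n w = 0\<^sub>v n"
    unfolding P_def w_def iter_B123_monomial_vec
    using monomial_vec_nilpotent[of "a - j" "b - j + n" "c - j + n"] by simp
  have kS': "k \<in> S'" using k dk unfolding S'_def by simp
  have "d k = 0"
    by (rule lincomb_vec_iterates_zero[OF P w nil _ inj rel' kS'])
       (use fin nz shape[OF kS'] in \<open>auto simp: S'_def\<close>)
  with dk show False ..
qed

lemma lincomb_monomial_vecs_zero:
  assumes fin: "finite S" and rel: "lincomb_vec n S c monomial_vec = 0\<^sub>v n"
    and k: "k \<in> S" and nz: "monomial_vec k \<noteq> 0\<^sub>v n"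
  shows "c k = 0"
proof -
  define K where "K = Suc (2 * (\<Sum>(a, b, c)\<in>S. a + b + c))"
  define ev where "ev = monomial_weight 2 (2 ^ K) (1 / 2 ^ Suc K)"
  obtain g where g: "g \<in> carrier_mat n n" and eig: "\<And>m. g *\<^sub>v monomial_vec m = ev m \<cdot>\<^sub>v monomial_vec m"
    using T0_eigenbasis[of 2 "2 ^ K" "1 / 2 ^ Suc K"] unfolding ev_def by auto
  define d where "d k' = (if ev k' = ev k then c k' else 0)" for k'
  have rel_d: "lincomb_vec n S d monomial_vec = 0\<^sub>v n"
    unfolding d_def by (rule lincomb_vec_eigencomponent_zero[OF g fin _ _ rel]) (simp_all add: eig)
  have small: "a + c' < K" if "(a, b, c) \<in> S" "(a', b', c') \<in> S" for a b c a' b' c'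
  proof -
    have "a + b + c \<le> (\<Sum>(a, b, c)\<in>S. a + b + c)" "a' + b' + c' \<le> (\<Sum>(a, b, c)\<in>S. a + b + c)"
      using member_le_sum[OF that(1), of "\<lambda>(a, b, c). a + b + c"]
        member_le_sum[OF that(2), of "\<lambda>(a, b, c). a + b + c"] fin by auto
    thus ?thesis unfolding K_def by linarith
  qed
  have "T0_weight k' = T0_weight k" if "k' \<in> S" "d k' \<noteq> 0" for k'
  proof -
    obtain a b c a' b' c' where k_eq: "k = (a, b, c)" and k': "k' = (a', b', c')"
      by (cases k, cases k')
    have "ev k' = ev k" using that(2) unfolding d_def by (simp split: if_splits)
    hence eq: "monomial_weight 2 (2 ^ K) (1 / 2 ^ Suc K) (a', b', c') =
        monomial_weight 2 (2 ^ K) (1 / 2 ^ Suc K) (a, b, c)"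
      unfolding k_eq k' ev_def .
    have m': "(a', b', c') \<in> S" and m: "(a, b, c) \<in> S" using that(1) k unfolding k' k_eq .
    show ?thesis
      unfolding k_eq k' using T0_weight_eq_of_monomial_weight_eq[OF small[OF m' m] small[OF m m'] eq] .
  qed
  hence "d k = 0" by (rule lincomb_monomial_vecs_zero_same_T0_weight[OF fin rel_d _ k nz])
  thus ?thesis unfolding d_def by simp
qed

lemma lincomb_monomial_vecs_rescale:
  assumes S: "finite S" and S': "finite S'"
    and eq: "lincomb_vec n S c monomial_vec = lincomb_vec n S' d monomial_vec"
  shows "lincomb_vec n S (\<lambda>k. \<psi> k * c k) monomial_vec = lincomb_vec n S' (\<lambda>k. \<psi> k * d k) monomial_vec"
proof -
  define U where "U = S \<union> S'"
  define c' where "c' k = (if k \<in> S then c k else 0)" for k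
  define d' where "d' k = (if k \<in> S' then d k else 0)" for k
  have U: "finite U" unfolding U_def using S S' by simp
  have ext: "lincomb_vec n S e monomial_vec = lincomb_vec n U (\<lambda>k. if k \<in> S then e k else 0) monomial_vec"
    "lincomb_vec n S' e monomial_vec = lincomb_vec n U (\<lambda>k. if k \<in> S' then e k else 0) monomial_vec"
    for e by (rule lincomb_vec_extend[OF U], simp add: U_def)+
  have diff: "lincomb_vec n U (\<lambda>k. c' k - d' k) monomial_vec = 0\<^sub>v n"
    unfolding lincomb_vec_diff c'_def d'_def using ext eq by simp
  have coeff: "c' k = d' k" if "k \<in> U" "monomial_vec k \<noteq> 0\<^sub>v n" for k
    using lincomb_monomial_vecs_zero[OF U diff that] by simp
  have "lincomb_vec n S (\<lambda>k. \<psi> k * c k) monomial_vec = lincomb_vec n U (\<lambda>k. \<psi> k * c' k) monomial_vec"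
    unfolding ext c'_def by (intro lincomb_vec_cong) simp
  also have "\<dots> = lincomb_vec n U (\<lambda>k. \<psi> k * d' k) monomial_vec"
  proof (rule lincomb_vec_cong)
    fix k i assume "k \<in> U" "i < n"
    thus "\<psi> k * c' k * monomial_vec k $ i = \<psi> k * d' k * monomial_vec k $ i"
      using coeff by (cases "monomial_vec k = 0\<^sub>v n") auto
  qed
  also have "\<dots> = lincomb_vec n S' (\<lambda>k. \<psi> k * d k) monomial_vec"
    unfolding ext d'_def by (intro lincomb_vec_cong) simp
  finally show ?thesis .
qed

lemma exists_diagonal_mat: "\<exists>G\<in>carrier_mat n n. \<forall>m. G *\<^sub>v monomial_vec m = \<psi> m \<cdot>\<^sub>v monomial_vec m"
proof -
  obtain T C where T: "finite T" and C: "\<And>j. j < n \<Longrightarrow> unit_vec n j = lincomb_vec n T (C j) monomial_vec"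
    using exists_common_support_span_vec[of n "unit_vec n" n monomial_vec]
    unfolding span_vec_monomial_vecs by auto
  define G where "G = mat n n (\<lambda>(i, j). lincomb_vec n T (\<lambda>k. \<psi> k * C j k) monomial_vec $ i)"
  have "G *\<^sub>v monomial_vec m = \<psi> m \<cdot>\<^sub>v monomial_vec m" for m
  proof -
    define D where "D k = (\<Sum>j<n. monomial_vec m $ j * C j k)" for k
    have "lincomb_vec n T D monomial_vec = lincomb_vec n {m} (\<lambda>_. 1) monomial_vec"
      using lincomb_vec_coordinates[OF C monomial_vec_carrier, of m]
        lincomb_vec_singleton[of monomial_vec m n "\<lambda>_. 1"] unfolding D_def by simp
    from lincomb_monomial_vecs_rescale[OF T _ this]
    have "lincomb_vec n T (\<lambda>k. \<psi> k * D k) monomial_vec = \<psi> m \<cdot>\<^sub>v monomial_vec m"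
      using lincomb_vec_singleton[of monomial_vec m n "\<lambda>k. \<psi> k * 1"] by simp
    moreover have "G *\<^sub>v monomial_vec m = lincomb_vec n T (\<lambda>k. \<psi> k * D k) monomial_vec"
      unfolding G_def mult_mat_of_lincomb_cols[OF monomial_vec_carrier] D_def
      by (intro lincomb_vec_cong) (simp add: sum_distrib_left mult_ac)
    ultimately show ?thesis by simp
  qed
  moreover have "G \<in> carrier_mat n n" unfolding G_def by simp
  ultimately show ?thesis by blast
qed

lemma exists_torus_conjugation:
  assumes t: "t1 \<noteq> 0" "t2 \<noteq> 0" "t3 \<noteq> 0"
  shows "\<exists>G H. G \<in> carrier_mat n n \<and> H \<in> carrier_mat n n \<and> G * H = 1\<^sub>m n \<and> H * G = 1\<^sub>m n \<and>
    G * (t1 \<cdot>\<^sub>m B1) * H = B1 \<and> G * (t2 \<cdot>\<^sub>m B2) * H = B2 \<and> G * (t3 \<cdot>\<^sub>m B3) * H = B3 \<and>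
    (\<forall>c. G *\<^sub>v mat_iter B3 c v = (1 / t3) ^ c \<cdot>\<^sub>v mat_iter B3 c v)"
proof -
  define \<psi> where "\<psi> = monomial_weight (1 / t1) (1 / t2) (1 / t3)"
  define \<phi> where "\<phi> = monomial_weight t1 t2 t3"
  obtain G where G: "G \<in> carrier_mat n n" and eG: "\<And>m. G *\<^sub>v monomial_vec m = \<psi> m \<cdot>\<^sub>v monomial_vec m"
    using exists_diagonal_mat by blast
  obtain H where H: "H \<in> carrier_mat n n" and eH: "\<And>m. H *\<^sub>v monomial_vec m = \<phi> m \<cdot>\<^sub>v monomial_vec m"
    using exists_diagonal_mat by blast
  have one: "1 \<cdot>\<^sub>m 1\<^sub>m n = (1\<^sub>m n :: complex mat)" by (intro eq_matI) auto
  have "G * (1 \<cdot>\<^sub>m 1\<^sub>m n) * H = 1\<^sub>m n" "H * (1 \<cdot>\<^sub>m 1\<^sub>m n) * G = 1\<^sub>m n"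
    by (rule diagonal_conjugation[of _ _ _ _ _ id], use G H eG eH t in
        \<open>auto simp: \<psi>_def \<phi>_def monomial_weight_def power_one_over field_simps split: prod.splits\<close>)+
  hence "G * H = 1\<^sub>m n" "H * G = 1\<^sub>m n" unfolding one using G H by simp_all
  moreover have "G * (t1 \<cdot>\<^sub>m B1) * H = B1"
    by (rule diagonal_conjugation[OF G H B1 eG eH, of "\<lambda>(a, b, c). (Suc a, b, c)"])
       (use t in \<open>auto simp: B1_monomial_vec \<psi>_def \<phi>_def monomial_weight_def power_one_over field_simps\<close>)
  moreover have "G * (t2 \<cdot>\<^sub>m B2) * H = B2"
    by (rule diagonal_conjugation[OF G H B2 eG eH, of "\<lambda>(a, b, c). (a, Suc b, c)"])
       (use t in \<open>auto simp: B2_monomial_vec \<psi>_def \<phi>_def monomial_weight_def power_one_over field_simps\<close>)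
  moreover have "G * (t3 \<cdot>\<^sub>m B3) * H = B3"
    by (rule diagonal_conjugation[OF G H B3 eG eH, of "\<lambda>(a, b, c). (a, b, Suc c)"])
       (use t in \<open>auto simp: B3_monomial_vec \<psi>_def \<phi>_def monomial_weight_def power_one_over field_simps\<close>)
  moreover have "\<forall>c. G *\<^sub>v mat_iter B3 c v = (1 / t3) ^ c \<cdot>\<^sub>v mat_iter B3 c v"
    using eG by (simp add: \<psi>_def monomial_weight_def flip: monomial_vec_00)
  ultimately show ?thesis using G H by blast
qed

end

section \<open>Framed representations with vanishing J\<close>

lemma A_mat_carrier: "A_mat r \<in> carrier_mat r r"
  unfolding A_mat_def by simp

lemma col_framing_eq_iter:
  fixes B3 I :: "complex mat"
  assumes B3: "B3 \<in> carrier_mat n n" and I: "I \<in> carrier_mat n r"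
    and BI: "B3 * I = I * A_mat r" and a: "a < r"
  shows "col I a = mat_iter B3 a (col I 0)"
  using a
proof (induction a)
  case (Suc a)
  have "col I (Suc a) = I *\<^sub>v col (A_mat r) a"
    using I Suc.prems by (intro eq_vecI) (auto simp: A_mat_def scalar_prod_def lessThan_atLeast0 if_distrib cong: if_cong)
  also have "\<dots> = col (B3 * I) a" using col_mult2[OF I A_mat_carrier, of a] BI Suc.prems by simp
  also have "\<dots> = B3 *\<^sub>v col I a" using col_mult2[OF B3 I, of a] Suc.prems by simp
  finally show ?case using Suc by simp
qed simp

lemma in_Q0_framing_nonempty:
  assumes Q: "in_Q0 r n (B1, B2, B3, I, J)" and n: "0 < n"
  shows "0 < r"
proof (rule ccontr)
  assume "\<not> 0 < r"
  hence r: "r = 0" by simp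
  have carr: "B1 \<in> carrier_mat n n" "B2 \<in> carrier_mat n n" "B3 \<in> carrier_mat n n" "I \<in> carrier_mat n r"
    using Q unfolding in_Q0_def is_rep_def by auto
  have "is_subspace n {0\<^sub>v n}" unfolding is_subspace_def by auto
  moreover have "\<forall>w\<in>{0\<^sub>v n}. B1 *\<^sub>v w \<in> {0\<^sub>v n} \<and> B2 *\<^sub>v w \<in> {0\<^sub>v n} \<and> B3 *\<^sub>v w \<in> {0\<^sub>v n}"
    using carr by simp
  moreover have "\<forall>u\<in>carrier_vec r. I *\<^sub>v u \<in> {0\<^sub>v n}"
    using carr r by (auto intro!: eq_vecI simp: scalar_prod_def)
  ultimately have "{0\<^sub>v n} = (carrier_vec n :: complex vec set)"
    using Q unfolding in_Q0_def cyclic_cond_def by auto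
  hence "unit_vec n 0 = (0\<^sub>v n :: complex vec)" by (metis singletonD unit_vec_carrier)
  thus False using n by (metis index_unit_vec(1) index_zero_vec(1) zero_neq_one)
qed

lemma in_Q0_commuting_cyclic_triple:
  assumes Q: "in_Q0 r n (B1, B2, B3, I, J)" and r: "0 < r"
  shows "commuting_cyclic_triple n B1 B2 B3 (col I 0)"
proof -
  have B1: "B1 \<in> carrier_mat n n" and B2: "B2 \<in> carrier_mat n n" and B3: "B3 \<in> carrier_mat n n"
    and I: "I \<in> carrier_mat n r" and J: "J = 0\<^sub>m r n"
    and moment: "B1 * B2 - B2 * B1 + I * J = 0\<^sub>m n n" and BI: "B3 * I = I * A_mat r"
    and c31: "B3 * B1 = B1 * B3" and c32: "B3 * B2 = B2 * B3"
    and cyc: "cyclic_cond r n (B1, B2, B3, I, J)"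
    using Q unfolding in_Q0_def is_rep_def by auto
  have cyclic: "\<And>W. is_subspace n W \<Longrightarrow> \<forall>w\<in>W. B1 *\<^sub>v w \<in> W \<and> B2 *\<^sub>v w \<in> W \<and> B3 *\<^sub>v w \<in> W \<Longrightarrow>
      \<forall>u\<in>carrier_vec r. I *\<^sub>v u \<in> W \<Longrightarrow> W = carrier_vec n"
    using cyc unfolding cyclic_cond_def by simp
  have "B1 * B2 = B2 * B1"
  proof (rule eq_matI)
    fix i j assume "i < dim_row (B2 * B1)" "j < dim_col (B2 * B1)"
    hence ij: "i < n" "j < n" using B1 B2 by auto
    have "(B1 * B2 - B2 * B1 + I * J) $$ (i, j) = 0" using moment ij by simp
    thus "(B1 * B2) $$ (i, j) = (B2 * B1) $$ (i, j)" using ij B1 B2 I J by (simp add: scalar_prod_def)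
  qed (use B1 B2 in auto)
  moreover have "W = carrier_vec n"
    if W: "is_subspace n W" and inv: "\<forall>w\<in>W. B1 *\<^sub>v w \<in> W \<and> B2 *\<^sub>v w \<in> W \<and> B3 *\<^sub>v w \<in> W"
      and v: "col I 0 \<in> W" for W
  proof -
    have iter: "mat_iter B3 a (col I 0) \<in> W" for a
      by (induction a) (use v inv in auto)
    have cols: "col I a \<in> W" if "a < r" for a
      by (subst col_framing_eq_iter[OF B3 I BI that]) (rule iter)
    have "I *\<^sub>v u \<in> W" if u: "u \<in> carrier_vec r" for u
    proof -
      have "I *\<^sub>v u = lincomb_vec n {..<r} (\<lambda>a. u $ a) (col I)"
        using I u by (intro eq_vecI) (auto simp: scalar_prod_def lessThan_atLeast0 mult.commute)
      also have "\<dots> \<in> W"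
        by (rule lincomb_vec_mem_subspace[OF W]) (simp_all add: cols)
      finally show ?thesis .
    qed
    thus ?thesis by (rule cyclic[OF W inv, rule_format])
  qed
  moreover have "col I 0 \<in> carrier_vec n" using I r by simp
  ultimately show ?thesis
    using B1 B2 B3 c31 c32 by unfold_locales simp_all
qed

lemma gl_act_torus_act:
  "gl_act g h (torus_act r n t1 t2 t3 (B1, B2, B3, I, J)) =
    (g * (t1 \<cdot>\<^sub>m B1) * h, g * (t2 \<cdot>\<^sub>m B2) * h, g * (t3 \<cdot>\<^sub>m B3) * h,
     g * mat n r (\<lambda>(i, a). t3 ^ a * I $$ (i, a)), mat r n (\<lambda>(a, j). t1 * t2 / t3 ^ a * J $$ (a, j)) * h)"
  unfolding gl_act_def torus_act_def by simp

lemma in_Q0_T0_fixed_triple: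
  assumes Q: "in_Q0 r n (B1, B2, B3, I, J)" and r: "0 < r" and T0: "T0_fixed r n (B1, B2, B3, I, J)"
  shows "T0_fixed_triple n B1 B2 B3 (col I 0)"
proof -
  interpret commuting_cyclic_triple n B1 B2 B3 "col I 0"
    by (rule in_Q0_commuting_cyclic_triple[OF Q r])
  have I: "I \<in> carrier_mat n r" using Q unfolding in_Q0_def is_rep_def by simp
  show ?thesis
  proof unfold_locales
    fix t1 t2 t3 :: complex assume t: "t1 * t2 * t3 = 1"
    hence t12: "t1 \<noteq> 0" "t2 \<noteq> 0" by auto
    have "t3 = t1 * t2 * t3 / (t1 * t2)" using t12 by simp
    hence t3: "1 / (t1 * t2) = t3" using t by simp
    have "fixed_by r n t1 t2 t3 (B1, B2, B3, I, J)"
      using T0 t12 t3 unfolding T0_fixed_def by metis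
    then obtain g h where g: "g \<in> carrier_mat n n" and h: "h \<in> carrier_mat n n" and hg: "h * g = 1\<^sub>m n"
      and act: "gl_act g h (torus_act r n t1 t2 t3 (B1, B2, B3, I, J)) = (B1, B2, B3, I, J)"
      unfolding fixed_by_def gl_equiv_def by blast
    hence c1: "g * (t1 \<cdot>\<^sub>m B1) * h = B1" and c2: "g * (t2 \<cdot>\<^sub>m B2) * h = B2"
      and c3: "g * (t3 \<cdot>\<^sub>m B3) * h = B3" and cI: "g * mat n r (\<lambda>(i, a). t3 ^ a * I $$ (i, a)) = I"
      unfolding gl_act_torus_act by simp_all
    have "col I 0 = g *\<^sub>v col (mat n r (\<lambda>(i, a). t3 ^ a * I $$ (i, a))) 0"
      using col_mult2[OF g _ r, of "mat n r (\<lambda>(i, a). t3 ^ a * I $$ (i, a))"] cI by simp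
    also have "col (mat n r (\<lambda>(i, a). t3 ^ a * I $$ (i, a))) 0 = col I 0"
      using I r by (intro eq_vecI) auto
    finally have "h *\<^sub>v col I 0 = (h * g) *\<^sub>v col I 0" using g h I r by simp
    hence "h *\<^sub>v col I 0 = col I 0" using hg I r by simp
    thus "\<exists>g\<in>carrier_mat n n. g * B1 = t1 \<cdot>\<^sub>m (B1 * g) \<and> g * B2 = t2 \<cdot>\<^sub>m (B2 * g) \<and>
        g * B3 = t3 \<cdot>\<^sub>m (B3 * g) \<and> g *\<^sub>v col I 0 = col I 0"
      using conj_smult_imp_twisted_commute[OF g h B1 hg c1] conj_smult_imp_twisted_commute[OF g h B2 hg c2]
        conj_smult_imp_twisted_commute[OF g h B3 hg c3] h by blast
  qed
qed

lemma fixed_by_zero_dim: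
  assumes "is_rep r 0 x"
  shows "fixed_by r 0 t1 t2 t3 x"
proof -
  obtain B1 B2 B3 I J where x: "x = (B1, B2, B3, I, J)" by (cases x)
  have "gl_act (1\<^sub>m 0) (1\<^sub>m 0) (torus_act r 0 t1 t2 t3 x) = x"
    using assms unfolding x gl_act_torus_act is_rep_def by (auto intro!: eq_matI)
  thus ?thesis unfolding fixed_by_def gl_equiv_def by (intro exI[of _ "1\<^sub>m 0"] conjI) simp_all
qed

lemma scaled_framing_conjugation:
  assumes G: "G \<in> carrier_mat n n" and B3: "B3 \<in> carrier_mat n n" and I: "I \<in> carrier_mat n r"
    and BI: "B3 * I = I * A_mat r" and t3: "t3 \<noteq> 0"
    and G3: "\<And>c. G *\<^sub>v mat_iter B3 c (col I 0) = (1 / t3) ^ c \<cdot>\<^sub>v mat_iter B3 c (col I 0)"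
  shows "G * mat n r (\<lambda>(i, a). t3 ^ a * I $$ (i, a)) = I"
proof (rule eq_matI)
  fix i a assume "i < dim_row I" "a < dim_col I"
  hence ia: "i < n" "a < r" using I by auto
  let ?I' = "mat n r (\<lambda>(i, a). t3 ^ a * I $$ (i, a))" and ?w = "mat_iter B3 a (col I 0)"
  have "col I 0 \<in> carrier_vec n" by (rule carrier_vecI) (use I in simp)
  hence w: "?w \<in> carrier_vec n" using B3 by simp
  have col_I: "col I a = ?w" using col_framing_eq_iter[OF B3 I BI ia(2)] .
  have "col ?I' a = t3 ^ a \<cdot>\<^sub>v col I a" using I ia by (intro eq_vecI) auto
  hence "col (G * ?I') a = G *\<^sub>v (t3 ^ a \<cdot>\<^sub>v ?w)"
    using col_mult2[OF G _ ia(2), of ?I'] col_I by simp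
  also have "\<dots> = ?w"
    using mult_mat_vec[OF G w] G3[of a] t3 by (simp add: smult_smult_assoc power_one_over)
  finally have "col (G * ?I') a $ i = col I a $ i" using col_I by simp
  thus "(G * ?I') $$ (i, a) = I $$ (i, a)" using G I ia by simp
qed (use G I in simp_all)

lemma in_Q0_T0_fixed_imp_fixed_by:
  assumes Q: "in_Q0 r n x" and T0: "T0_fixed r n x"
    and t: "t1 \<noteq> 0" "t2 \<noteq> 0" "t3 \<noteq> 0"
  shows "fixed_by r n t1 t2 t3 x"
proof (cases "n = 0")
  case True
  thus ?thesis using fixed_by_zero_dim Q unfolding in_Q0_def by blast
next
  case False
  obtain B1 B2 B3 I J where x: "x = (B1, B2, B3, I, J)" by (cases x)
  have B3: "B3 \<in> carrier_mat n n" and I: "I \<in> carrier_mat n r" and J: "J = 0\<^sub>m r n"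
    and BI: "B3 * I = I * A_mat r"
    using Q unfolding x in_Q0_def is_rep_def by auto
  have r: "0 < r" using in_Q0_framing_nonempty Q False unfolding x by blast
  interpret T0_fixed_triple n B1 B2 B3 "col I 0"
    using in_Q0_T0_fixed_triple Q T0 r unfolding x by blast
  obtain G H where G: "G \<in> carrier_mat n n" and H: "H \<in> carrier_mat n n"
    and GH: "G * H = 1\<^sub>m n" "H * G = 1\<^sub>m n"
    and conj: "G * (t1 \<cdot>\<^sub>m B1) * H = B1" "G * (t2 \<cdot>\<^sub>m B2) * H = B2" "G * (t3 \<cdot>\<^sub>m B3) * H = B3"
    and G3: "\<And>c. G *\<^sub>v mat_iter B3 c (col I 0) = (1 / t3) ^ c \<cdot>\<^sub>v mat_iter B3 c (col I 0)"
    using exists_torus_conjugation[OF t] by blast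
  have "mat r n (\<lambda>(a, j). t1 * t2 / t3 ^ a * J $$ (a, j)) = 0\<^sub>m r n" unfolding J by (intro eq_matI) auto
  hence "gl_act G H (torus_act r n t1 t2 t3 x) = x"
    unfolding x gl_act_torus_act
    using conj scaled_framing_conjugation[OF G B3 I BI t(3) G3] H J by simp
  thus ?thesis unfolding fixed_by_def gl_equiv_def using G H GH by blast
qed

theorem lemma4p6:
  fixes r n :: nat and x :: rep_data
  assumes "in_Q0 r n x"
  shows "T0_fixed r n x \<longleftrightarrow> T_fixed r n x"
proof
  assume "T0_fixed r n x"
  thus "T_fixed r n x"
    unfolding T_fixed_def using in_Q0_T0_fixed_imp_fixed_by[OF assms] by blast
qed (simp add: T_fixed_def T0_fixed_def)

end
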